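(* (i) Let $A$ be a C$^*$-algebra and let $\Delta:A\to A$ be a weak-2-local $^*$-derivation, that is, a map (not assumed linear nor continuous) such that for every $a,b\in A$ and $\phi\in A^*$ there exists a $^*$-derivation $D_{a,b,\phi}:A\to A$ with $\phi(\Delta(a))=\phi(D_{a,b,\phi}(a))$ and $\phi(\Delta(b))=\phi(D_{a,b,\phi}(b))$. Then $\Delta$ is linear. (ii) Let $A$ and $B$ be C$^*$-algebras and let $\Delta:A\to B$ be a weak-2-local $^*$-homomorphism, that is, a map (not assumed linear nor continuous) such that for every $a,b\in A$ and $\phi\in B^*$ there exists a $^*$-homomorphism $\pi_{a,b,\phi}:A\to B$ with $\phi(\Delta(a))=\phi(\pi_{a,b,\phi}(a))$ and $\phi(\Delta(b))=\phi(\pi_{a,b,\phi}(b))$. Then $\Delta$ is linear.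
   Context: A derivation on $A$ is a linear map $D:A\to A$ with $D(xy)=D(x)y+xD(y)$ for all $x,y\in A$; a $^*$-derivation is a derivation $D$ with $D(x^* )=D(x)^*$ for all $x\in A$. A $^*$-homomorphism is a linear, multiplicative map $\pi$ with $\pi(x^* )=\pi(x)^*$ for all $x$. $A^*$ and $B^*$ denote the Banach duals. *)

theory Defs
  imports Complex_Main
begin

class scaleC =
  fixes scaleC :: "complex \<Rightarrow> 'a \<Rightarrow> 'a"  (infixr "*\<^sub>C" 75)

class star =
  fixes star :: "'a \<Rightarrow> 'a"  ("(_\<^sup>\<star>)" [1000] 1000)

(* Complex C*-algebras, not assumed to be unital. The real structure inherited from
   real_normed_algebra is the restriction of the complex one (scaleR_scaleC), so
   1 *\<^sub>C x = x follows, and continuity of the star follows from the C*-identity. *)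
class cstar_algebra = real_normed_algebra + banach + scaleC + star +
  assumes scaleR_scaleC: "r *\<^sub>R x = complex_of_real r *\<^sub>C x"
    and scaleC_add_right: "c *\<^sub>C (x + y) = c *\<^sub>C x + c *\<^sub>C y"
    and scaleC_add_left: "(c + d) *\<^sub>C x = c *\<^sub>C x + d *\<^sub>C x"
    and scaleC_scaleC: "c *\<^sub>C d *\<^sub>C x = (c * d) *\<^sub>C x"
    and mult_scaleC_left: "c *\<^sub>C x * y = c *\<^sub>C (x * y)"
    and mult_scaleC_right: "x * c *\<^sub>C y = c *\<^sub>C (x * y)"
    and norm_scaleC: "norm (c *\<^sub>C x) = cmod c * norm x"
    and star_star: "(x\<^sup>\<star>)\<^sup>\<star> = x"
    and star_add: "(x + y)\<^sup>\<star> = x\<^sup>\<star> + y\<^sup>\<star>"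
    and star_scaleC: "(c *\<^sub>C x)\<^sup>\<star> = cnj c *\<^sub>C x\<^sup>\<star>"
    and star_mult: "(x * y)\<^sup>\<star> = y\<^sup>\<star> * x\<^sup>\<star>"
    and norm_star_mult: "norm (x\<^sup>\<star> * x) = (norm x)\<^sup>2"

lemma scaleC_vector_space: "vector_space (scaleC :: complex \<Rightarrow> 'a::cstar_algebra \<Rightarrow> 'a)"
proof
  fix x :: 'a
  show "1 *\<^sub>C x = x"
    using scaleR_scaleC[of 1 x] by simp
qed (simp_all add: scaleC_add_right scaleC_add_left scaleC_scaleC)

instantiation complex :: cstar_algebra
begin

definition scaleC_complex :: "complex \<Rightarrow> complex \<Rightarrow> complex" where
  "scaleC_complex c x = c * x"

definition star_complex :: "complex \<Rightarrow> complex" where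
  "star_complex x = cnj x"

instance
  by standard
    (simp_all add: scaleC_complex_def star_complex_def scaleR_conv_of_real algebra_simps
      norm_mult power2_eq_square)

end

abbreviation clinear :: "('a::cstar_algebra \<Rightarrow> 'b::cstar_algebra) \<Rightarrow> bool" where
  "clinear f \<equiv> Vector_Spaces.linear scaleC scaleC f"

definition banach_dual :: "('a::cstar_algebra \<Rightarrow> complex) set" where
  "banach_dual = {\<phi>. clinear \<phi> \<and> continuous_on UNIV \<phi>}"

definition derivation :: "('a::cstar_algebra \<Rightarrow> 'a) \<Rightarrow> bool" where
  "derivation D \<longleftrightarrow> clinear D \<and> (\<forall>x y. D (x * y) = D x * y + x * D y)"

definition star_derivation :: "('a::cstar_algebra \<Rightarrow> 'a) \<Rightarrow> bool" where
  "star_derivation D \<longleftrightarrow> derivation D \<and> (\<forall>x. D (x\<^sup>\<star>) = (D x)\<^sup>\<star>)"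

definition star_homomorphism :: "('a::cstar_algebra \<Rightarrow> 'b::cstar_algebra) \<Rightarrow> bool" where
  "star_homomorphism \<pi> \<longleftrightarrow>
     clinear \<pi> \<and> (\<forall>x y. \<pi> (x * y) = \<pi> x * \<pi> y) \<and> (\<forall>x. \<pi> (x\<^sup>\<star>) = (\<pi> x)\<^sup>\<star>)"

definition weak_2_local_star_derivation :: "('a::cstar_algebra \<Rightarrow> 'a) \<Rightarrow> bool" where
  "weak_2_local_star_derivation \<Delta> \<longleftrightarrow>
     (\<forall>a b. \<forall>\<phi>\<in>banach_dual. \<exists>D. star_derivation D \<and>
        \<phi> (\<Delta> a) = \<phi> (D a) \<and> \<phi> (\<Delta> b) = \<phi> (D b))"

definition weak_2_local_star_homomorphism ::
    "('a::cstar_algebra \<Rightarrow> 'b::cstar_algebra) \<Rightarrow> bool" where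
  "weak_2_local_star_homomorphism \<Delta> \<longleftrightarrow>
     (\<forall>a b. \<forall>\<phi>\<in>banach_dual. \<exists>\<pi>. star_homomorphism \<pi> \<and>
        \<phi> (\<Delta> a) = \<phi> (\<pi> a) \<and> \<phi> (\<Delta> b) = \<phi> (\<pi> b))"

end

theory Submission imports Defs begin

text \<open>
  Only linearity and symmetry \<open>T (x\<^sup>\<star>) = (T x)\<^sup>\<star>\<close> of the approximating maps matter. Let \<open>\<phi>\<close>
  be a symmetric functional on the codomain, and let \<open>h\<close>, \<open>k\<close> be self-adjoint. Then \<open>\<phi>\<close> is real on
  \<open>T h\<close> and \<open>T k\<close>, so a single value \<open>\<phi> (T (h + \<i>k))\<close> determines both \<open>\<phi> (T h)\<close> and
  \<open>\<phi> (T k)\<close>. Comparing the pairs \<open>(h + \<i>k, h)\<close>, \<open>(h + \<i>k, k)\<close> and \<open>(h + \<i>k, h + k)\<close> gives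
  \<open>\<phi> (\<Delta> (h + \<i>k)) = \<phi> (\<Delta> h) + \<i> \<phi> (\<Delta> k)\<close> and
  \<open>\<phi> (\<Delta> (h + k)) = \<phi> (\<Delta> h) + \<phi> (\<Delta> k)\<close>. By Hahn--Banach, the symmetric functionals separate
  points.
\<close>

section \<open>The Hahn--Banach theorem\<close>

text \<open>Homogeneity is required only as an inequality, which passes directly to infima; equality
  is recovered in \<open>sublinear_scaleR\<close> by scaling back with
  \<open>inverse r\<close>.\<close>

definition sublinear :: "('a::real_vector \<Rightarrow> real) \<Rightarrow> bool" where
  "sublinear p \<longleftrightarrow> (\<forall>x y. p (x + y) \<le> p x + p y) \<and> (\<forall>r\<ge>0. \<forall>x. p (r *\<^sub>R x) \<le> r * p x)"

lemma sublinear_add: "sublinear p \<Longrightarrow> p (x + y) \<le> p x + p y"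
  by (simp add: sublinear_def)

lemma sublinear_scaleR_le: "sublinear p \<Longrightarrow> r \<ge> 0 \<Longrightarrow> p (r *\<^sub>R x) \<le> r * p x"
  by (simp add: sublinear_def)

lemma sublinear_zero: "sublinear p \<Longrightarrow> p 0 = 0"
  using sublinear_add[of p 0 0] sublinear_scaleR_le[of p 0 0] by simp

lemma sublinear_minus: "sublinear p \<Longrightarrow> - p (- x) \<le> p x"
  using sublinear_add[of p x "- x"] sublinear_zero[of p] by simp

lemma sublinear_scaleR:
  assumes "sublinear p" "r \<ge> 0"
  shows "p (r *\<^sub>R x) = r * p x"
proof (cases "r = 0")
  case True
  then show ?thesis using sublinear_zero[OF assms(1)] by simp
next
  case False
  then have "p x \<le> inverse r * p (r *\<^sub>R x)"
    using sublinear_scaleR_le[OF assms(1), of "inverse r" "r *\<^sub>R x"] assms(2) by simp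
  then have "r * p x \<le> p (r *\<^sub>R x)"
    using False assms(2) by (simp add: field_simps)
  then show ?thesis
    using sublinear_scaleR_le[OF assms, of x] by simp
qed

lemma sublinear_norm: "sublinear (norm :: 'a::real_normed_vector \<Rightarrow> real)"
  by (simp add: sublinear_def norm_triangle_ineq)

text \<open>The one tool for lowering a sublinear functional. It forces a minimal functional to be
  odd, and it lowers the norm so that a dominated linear functional cannot vanish at
  \<open>x\<close>.\<close>

lemma sublinear_shift:
  assumes p: "sublinear p"
  obtains q where "sublinear q" "q \<le> p" "q (- x) \<le> - p x"
proof
  \<comment> \<open>The parameter \<open>t = 0\<close> yields \<open>q \<le> p\<close>;
    \<open>t = 1\<close> at \<open>- x\<close> yields the bound \<open>p 0 - p x\<close>.\<close>
  define q where "q y = (INF t\<in>{0..}. p (y + t *\<^sub>R x) - t * p x)" for y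
  have bdd: "bdd_below ((\<lambda>t. p (y + t *\<^sub>R x) - t * p x) ` {0..})" for y
  \<comment> \<open>Subadditivity on \<open>t *\<^sub>R x = - y + (y + t *\<^sub>R x)\<close> gives
    a lower bound independent of \<open>t\<close>.\<close>
  proof (rule bdd_belowI2[where m = "- p (- y)"])
    fix t :: real
    assume "t \<in> {0..}"
    then show "- p (- y) \<le> p (y + t *\<^sub>R x) - t * p x"
      using sublinear_add[OF p, of "- y" "y + t *\<^sub>R x"] sublinear_scaleR[OF p, of t x] by simp
  qed
  have q_le: "q y \<le> p (y + t *\<^sub>R x) - t * p x" if "t \<ge> 0" for y t
    unfolding q_def by (rule cINF_lower[OF bdd]) (use that in simp)
  have q_ge: "c \<le> q y" if "\<And>t. t \<ge> 0 \<Longrightarrow> c \<le> p (y + t *\<^sub>R x) - t * p x" for c y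
    unfolding q_def by (rule cINF_greatest) (use that in auto)
  show "q \<le> p"
    using q_le[of 0] by (auto simp: le_fun_def)
  show "q (- x) \<le> - p x"
    using q_le[of 1 "- x"] sublinear_zero[OF p] by simp
  have "q (y + z) \<le> q y + q z" for y z
  proof -
    \<comment> \<open>Parameters add: \<open>s\<close> for \<open>y\<close> and \<open>t\<close> for
      \<open>z\<close> give \<open>s + t\<close> for the sum. The infimum is then taken over
      \<open>t\<close> first and over \<open>s\<close> afterwards.\<close>
    have *: "q (y + z) \<le> (p (y + s *\<^sub>R x) - s * p x) + (p (z + t *\<^sub>R x) - t * p x)"
      if "s \<ge> 0" "t \<ge> 0" for s t
      using q_le[of "s + t" "y + z"] that
        sublinear_add[OF p, of "y + s *\<^sub>R x" "z + t *\<^sub>R x"]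
      by (simp add: algebra_simps)
    have "q (y + z) - (p (y + s *\<^sub>R x) - s * p x) \<le> q z" if "s \<ge> 0" for s
      by (intro q_ge) (use *[OF that] in \<open>simp add: algebra_simps\<close>)
    then have "q (y + z) - q z \<le> q y"
      by (intro q_ge) (simp add: algebra_simps)
    then show ?thesis by simp
  qed
  moreover have "q (r *\<^sub>R y) \<le> r * q y" if "r \<ge> 0" for r y
  proof (cases "r = 0")
    case True
    then show ?thesis using q_le[of 0 0] sublinear_zero[OF p] by simp
  next
    case False
    with that have r: "r > 0" by simp
    \<comment> \<open>The parameter \<open>t\<close> at \<open>y\<close> corresponds to
      \<open>r * t\<close> at \<open>r *\<^sub>R y\<close>.\<close>
    have "q (r *\<^sub>R y) \<le> r * (p (y + t *\<^sub>R x) - t * p x)" if "t \<ge> 0" for t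
      using q_le[of "r * t" "r *\<^sub>R y"] that r sublinear_scaleR[OF p, of r "y + t *\<^sub>R x"]
      by (simp add: algebra_simps)
    then have "q (r *\<^sub>R y) / r \<le> q y"
      using r by (intro q_ge) (simp add: divide_le_eq mult.commute)
    then show ?thesis
      using r by (simp add: divide_le_eq mult.commute)
  qed
  ultimately show "sublinear q" by (simp add: sublinear_def)
qed

text \<open>Supplies the chain condition of Zorn's lemma. The pointwise infimum works: it is finite
  because \<open>- p0 (- x) \<le> - p (- x) \<le> p x\<close>, and the chain property preserves
  subadditivity.\<close>

lemma sublinear_chain_lower_bound:
  assumes C: "C \<noteq> {}" "\<And>p. p \<in> C \<Longrightarrow> sublinear p \<and> p \<le> p0"
    and chain: "\<And>p q. p \<in> C \<Longrightarrow> q \<in> C \<Longrightarrow> p \<le> q \<or> q \<le> p"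
  obtains q where "sublinear q" "\<And>p. p \<in> C \<Longrightarrow> q \<le> p"
proof
  define q where "q x = (INF p\<in>C. p x)" for x
  have bdd: "bdd_below ((\<lambda>p. p x) ` C)" for x
  proof (rule bdd_belowI2[where m = "- p0 (- x)"])
    fix p
    assume "p \<in> C"
    then show "- p0 (- x) \<le> p x"
      using sublinear_minus[of p x] C(2)[of p] by (force simp: le_fun_def dest: spec[of _ "- x"])
  qed
  have q_le: "q x \<le> p x" if "p \<in> C" for p x
    unfolding q_def by (rule cINF_lower[OF bdd that])
  have q_ge: "c \<le> q x" if "\<And>p. p \<in> C \<Longrightarrow> c \<le> p x" for c x
    unfolding q_def by (rule cINF_greatest) (use that C in auto)
  show "q \<le> p" if "p \<in> C" for p
    using q_le[OF that] by (simp add: le_fun_def)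
  have "q (x + y) \<le> q x + q y" for x y
  proof -
    have *: "q (x + y) \<le> p x + p' y" if pp: "p \<in> C" "p' \<in> C" for p p'
    proof -
      \<comment> \<open>The smaller of \<open>p\<close> and \<open>p'\<close> lies below both, so a
        single sublinear functional bounds the mixed sum.\<close>
      obtain m where m: "m \<in> C" "m \<le> p" "m \<le> p'"
        using chain[OF pp] pp by blast
      have "q (x + y) \<le> m x + m y"
        using q_le[OF m(1)] sublinear_add[of m x y] C(2)[OF m(1)] by (meson order_trans)
      also have "\<dots> \<le> p x + p' y"
        using m by (intro add_mono) (auto simp: le_fun_def)
      finally show ?thesis .
    qed
    have "q (x + y) - p x \<le> q y" if "p \<in> C" for p
      by (intro q_ge) (use *[OF that] in \<open>simp add: algebra_simps\<close>)
    then have "q (x + y) - q y \<le> q x"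
      by (intro q_ge) (simp add: algebra_simps)
    then show ?thesis by simp
  qed
  moreover have "q (r *\<^sub>R x) \<le> r * q x" if "r \<ge> 0" for r x
  proof (cases "r = 0")
    case True
    obtain p where "p \<in> C" using C(1) by blast
    then show ?thesis
      using q_le[of p 0] sublinear_zero[of p] C(2)[of p] True by simp
  next
    case False
    with that have r: "r > 0" by simp
    have "q (r *\<^sub>R x) \<le> r * p x" if "p \<in> C" for p
      using q_le[OF that, of "r *\<^sub>R x"] sublinear_scaleR_le[of p r x] C(2)[OF that] r by simp
    then have "q (r *\<^sub>R x) / r \<le> q x"
      using r by (intro q_ge) (simp add: divide_le_eq mult.commute)
    then show ?thesis
      using r by (simp add: divide_le_eq mult.commute)
  qed
  ultimately show "sublinear q" by (simp add: sublinear_def)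
qed

text \<open>A minimal sublinear functional is linear: by minimality it equals each of its shifts, which
  makes it odd.\<close>

theorem Hahn_Banach_dominated:
  fixes p0 :: "'a::real_vector \<Rightarrow> real"
  assumes p0: "sublinear p0"
  obtains f where "linear f" "f \<le> p0"
proof -
  define S where "S = {p. sublinear p \<and> p \<le> p0}"
  have "\<exists>p\<in>S. \<forall>q\<in>S. q \<le> p \<longrightarrow> q = p"
  \<comment> \<open>The order is reversed, so that the maximal element from Zorn's lemma is a
    minimal sublinear functional.\<close>
  proof (rule predicate_Zorn[where P = "\<lambda>p q. q \<le> p" and A = S])
    show "partial_order_on S (relation_of (\<lambda>p q. q \<le> p) S)"
      by (rule partial_order_on_relation_ofI) auto
  next
    fix C
    assume "C \<in> Chains (relation_of (\<lambda>p q. q \<le> p) S)"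
    then have chain: "p \<in> S \<and> (p \<le> q \<or> q \<le> p)" if "p \<in> C" "q \<in> C" for p q
      using that by (auto simp: Chains_def relation_of_def)
    show "\<exists>u\<in>S. \<forall>p\<in>C. u \<le> p"
    proof (cases "C = {}")
      case True
      then show ?thesis using p0 by (auto simp: S_def)
    next
      case False
      obtain q where q: "sublinear q" "\<And>p. p \<in> C \<Longrightarrow> q \<le> p"
        using sublinear_chain_lower_bound[OF False, of p0] chain
        by (metis (no_types, lifting) S_def mem_Collect_eq)
      moreover have "q \<le> p0"
        using False q(2) chain by (force simp: S_def intro: order_trans)
      ultimately show ?thesis by (auto simp: S_def)
    qed
  qed
  then obtain f where f: "sublinear f" "f \<le> p0" and min: "\<And>q. q \<in> S \<Longrightarrow> q \<le> f \<Longrightarrow> q = f"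
    by (auto simp: S_def)
  have odd: "f (- x) = - f x" for x
  proof -
    obtain q where q: "sublinear q" "q \<le> f" "q (- x) \<le> - f x"
      using sublinear_shift[OF f(1)] .
    then have "q = f"
      using f(2) by (intro min) (auto simp: S_def)
    then show ?thesis
      using q(3) sublinear_minus[OF f(1), of x] by simp
  qed
  \<comment> \<open>For an odd \<open>f\<close>, subadditivity at \<open>- x\<close> and
    \<open>- y\<close> is the reverse inequality.\<close>
  have "f (x + y) = f x + f y" for x y
    using sublinear_add[OF f(1), of x y] sublinear_add[OF f(1), of "- x" "- y"] odd[of "x + y"]
      odd[of x] odd[of y] by simp
  moreover have "f (r *\<^sub>R x) = r * f x" for r x
  proof (cases "r \<ge> 0")
    case True
    then show ?thesis by (rule sublinear_scaleR[OF f(1)])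
  next
    case False
    then show ?thesis
      using sublinear_scaleR[OF f(1), of "- r" x] odd[of "r *\<^sub>R x"] by simp
  qed
  ultimately have "linear f"
    by (intro linearI) simp_all
  then show thesis using f(2) that by blast
qed

text \<open>The norm is shifted at \<open>x\<close> before Hahn-Banach is applied: any linear
  \<open>f\<close> below the shift satisfies \<open>f (- x) \<le> - norm x\<close>, hence
  \<open>f x > 0\<close>, and it is still dominated by the norm.\<close>

corollary bounded_linear_separates_zero:
  fixes x :: "'a::real_normed_vector"
  assumes "x \<noteq> 0"
  obtains f :: "'a \<Rightarrow> real" where "bounded_linear f" "f x \<noteq> 0"
proof -
  obtain q where q: "sublinear q" "q \<le> norm" "q (- x) \<le> - norm x"
    using sublinear_shift[OF sublinear_norm, of x] .
  obtain f where f: "linear f" "f \<le> q"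
    using Hahn_Banach_dominated[OF q(1)] .
  have le: "f y \<le> norm y" for y
    using f(2) q(2) by (meson le_funD order_trans)
  have "\<bar>f y\<bar> \<le> norm y" for y
    using le[of y] le[of "- y"] by (simp add: linear_neg[OF f(1)])
  then have "bounded_linear f"
    using f(1) by (auto simp: bounded_linear_def bounded_linear_axioms_def intro!: exI[of _ 1])
  moreover have "f (- x) \<le> - norm x"
    using f(2) q(3) by (meson le_funD order_trans)
  then have "f x \<noteq> 0"
    using assms by (auto simp: linear_neg[OF f(1)])
  ultimately show thesis using that by blast
qed

section \<open>Symmetric functionals on a C*-algebra\<close>

interpretation scaleC: vector_space "scaleC :: complex \<Rightarrow> 'a::cstar_algebra \<Rightarrow> 'a"
  by (rule scaleC_vector_space)

lemma clinear_iff: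
  "clinear f \<longleftrightarrow> (\<forall>x y. f (x + y) = f x + f y) \<and> (\<forall>c x. f (c *\<^sub>C x) = c *\<^sub>C f x)"
  by (simp add: Vector_Spaces.linear_iff scaleC_vector_space)

lemma star_diff: "(x - y)\<^sup>\<star> = x\<^sup>\<star> - (y::'a::cstar_algebra)\<^sup>\<star>"
proof -
  have "(x - y)\<^sup>\<star> + y\<^sup>\<star> = x\<^sup>\<star>"
    by (simp flip: star_add)
  then show ?thesis by (simp add: algebra_simps)
qed

text \<open>The C*-identity and submultiplicativity give
  \<open>norm y * norm y \<le> norm (y\<^sup>\<star>) * norm y\<close>; cancel, then use this for
  both \<open>x\<close> and its adjoint.\<close>

lemma norm_star: "norm (x\<^sup>\<star>) = norm (x::'a::cstar_algebra)"
proof -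
  have le: "norm y \<le> norm (y\<^sup>\<star>)" for y :: 'a
  proof (cases "y = 0")
    case False
    have "norm y * norm y \<le> norm (y\<^sup>\<star>) * norm y"
      using norm_mult_ineq[of "y\<^sup>\<star>" y] by (simp add: norm_star_mult power2_eq_square)
    then show ?thesis using False by simp
  qed simp
  show ?thesis using le[of x] le[of "x\<^sup>\<star>"] by (simp add: star_star)
qed

lemma bounded_linear_star: "bounded_linear (star :: 'a::cstar_algebra \<Rightarrow> 'a)"
  by (rule bounded_linear_intro[where K = 1])
    (simp_all add: star_add star_scaleC scaleR_scaleC norm_star)

lemma bounded_linear_scaleC: "bounded_linear (\<lambda>x::'a::cstar_algebra. c *\<^sub>C x)"
  by (rule bounded_linear_intro[where K = "cmod c"])
    (simp_all add: scaleC_add_right scaleR_scaleC scaleC_scaleC norm_scaleC mult.commute)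

definition re_part :: "'a::cstar_algebra \<Rightarrow> 'a" where
  "re_part x = (1 / 2) *\<^sub>C (x + x\<^sup>\<star>)"

definition im_part :: "'a::cstar_algebra \<Rightarrow> 'a" where
  "im_part x = (- \<i> / 2) *\<^sub>C (x - x\<^sup>\<star>)"

lemma star_re_part: "(re_part x)\<^sup>\<star> = re_part x"
  by (simp add: re_part_def star_scaleC star_add star_star add.commute)

lemma star_im_part: "(im_part x)\<^sup>\<star> = im_part x"
  by (simp add: im_part_def star_scaleC star_diff star_star scaleC.scale_right_diff_distrib)

lemma re_im_part: "re_part x + \<i> *\<^sub>C im_part x = x"
proof -
  have "re_part x + \<i> *\<^sub>C im_part x = (1 / 2) *\<^sub>C ((x + x\<^sup>\<star>) + (x - x\<^sup>\<star>))"
    unfolding re_part_def im_part_def scaleC_add_right[of "1 / 2"]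
    by (simp add: scaleC_scaleC)
  also have "\<dots> = (1 / 2) *\<^sub>C x + (1 / 2) *\<^sub>C x"
    by (simp add: scaleC_add_right)
  also have "\<dots> = x"
    by (simp flip: scaleC_add_left)
  finally show ?thesis .
qed

lemma re_part_add: "re_part (x + y) = re_part x + re_part y"
  by (simp add: re_part_def star_add algebra_simps)

lemma im_part_add: "im_part (x + y) = im_part x + im_part y"
  by (simp add: im_part_def star_add algebra_simps)

text \<open>The coefficients are real so that a real-linear functional can be applied term by term;
  the same holds for \<open>im_part_scaleC\<close>.\<close>

lemma re_part_scaleC: "re_part (c *\<^sub>C x) = Re c *\<^sub>R re_part x - Im c *\<^sub>R im_part x"
proof -
  obtain a b where "c = complex_of_real a + \<i> * complex_of_real b"
    by (metis complex_eq)
  then show ?thesis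
    by (simp add: re_part_def im_part_def scaleR_scaleC star_scaleC star_add
        scaleC_add_right scaleC_add_left scaleC_scaleC scaleC.scale_right_diff_distrib
        scaleC.scale_left_diff_distrib star_diff distrib_left mult.commute)
qed

lemma im_part_scaleC: "im_part (c *\<^sub>C x) = Im c *\<^sub>R re_part x + Re c *\<^sub>R im_part x"
proof -
  obtain a b where "c = complex_of_real a + \<i> * complex_of_real b"
    by (metis complex_eq)
  then show ?thesis
    by (simp add: re_part_def im_part_def scaleR_scaleC star_scaleC star_add
        scaleC_add_right scaleC_add_left scaleC_scaleC scaleC.scale_right_diff_distrib
        scaleC.scale_left_diff_distrib star_diff distrib_left mult.commute)
qed

lemma bounded_linear_re_part: "bounded_linear re_part"
  unfolding re_part_def
  by (intro bounded_linear_compose[OF bounded_linear_scaleC] bounded_linear_add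
      bounded_linear_ident bounded_linear_star)

lemma bounded_linear_im_part: "bounded_linear im_part"
  unfolding im_part_def
  by (intro bounded_linear_compose[OF bounded_linear_scaleC] bounded_linear_sub
      bounded_linear_ident bounded_linear_star)

lemma symmetric_functional_separates:
  fixes x y :: "'a::cstar_algebra"
  assumes eq: "\<And>\<phi>. \<phi> \<in> banach_dual \<Longrightarrow> (\<And>z. \<phi> (z\<^sup>\<star>) = cnj (\<phi> z)) \<Longrightarrow> \<phi> x = \<phi> y"
  shows "x = y"
proof (rule ccontr)
  assume "x \<noteq> y"
  define w where "w = x - y"
  have "re_part w \<noteq> 0 \<or> im_part w \<noteq> 0"
    using re_im_part[of w] \<open>x \<noteq> y\<close> by (auto simp: w_def)
  then obtain f where f: "bounded_linear f" and fw: "f (re_part w) \<noteq> 0 \<or> f (im_part w) \<noteq> (0::real)"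
    using bounded_linear_separates_zero by metis
  interpret f: bounded_linear f by (rule f)
  \<comment> \<open>The complex-linear extension of \<open>f\<close> restricted to self-adjoint
    elements. It is symmetric because the star fixes \<open>re_part\<close> and negates
    \<open>im_part\<close>.\<close>
  define \<phi> where "\<phi> z = Complex (f (re_part z)) (f (im_part z))" for z
  have add: "\<phi> (u + v) = \<phi> u + \<phi> v" for u v
    by (simp add: \<phi>_def re_part_add im_part_add f.add complex_eq_iff)
  have scale: "\<phi> (c *\<^sub>C u) = c * \<phi> u" for c u
    by (simp add: \<phi>_def re_part_scaleC im_part_scaleC f.add f.diff f.scale complex_eq_iff)
  have sym: "\<phi> (z\<^sup>\<star>) = cnj (\<phi> z)" for z
  proof -
    have "re_part (z\<^sup>\<star>) = re_part z" "im_part (z\<^sup>\<star>) = - im_part z"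
      by (simp_all add: re_part_def im_part_def star_star add.commute
          scaleC.scale_right_diff_distrib)
    then show ?thesis by (simp add: \<phi>_def f.neg complex_eq_iff)
  qed
  have "continuous_on UNIV \<phi>"
    unfolding \<phi>_def
    by (intro continuous_on_Complex f.continuous_on continuous_on_id
        bounded_linear.continuous_on[OF bounded_linear_re_part]
        bounded_linear.continuous_on[OF bounded_linear_im_part])
  then have "\<phi> \<in> banach_dual"
    using add scale by (simp add: banach_dual_def clinear_iff scaleC_complex_def)
  then have "\<phi> (w + y) = \<phi> y"
    using eq sym by (simp add: w_def)
  then have "\<phi> w = 0"
    by (simp add: add)
  then show False
    using fw by (simp add: \<phi>_def complex_eq_iff)
qed

section \<open>Weak-2-local symmetric maps\<close>

text \<open>Common generalisation of the two weak-2-local notions, so that one linearity proof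
  covers both.\<close>

definition weak_2_local_symmetric :: "('a::cstar_algebra \<Rightarrow> 'b::cstar_algebra) \<Rightarrow> bool" where
  "weak_2_local_symmetric \<Delta> \<longleftrightarrow>
     (\<forall>a b. \<forall>\<phi>\<in>banach_dual. \<exists>T. clinear T \<and> (\<forall>x. T (x\<^sup>\<star>) = (T x)\<^sup>\<star>) \<and>
        \<phi> (\<Delta> a) = \<phi> (T a) \<and> \<phi> (\<Delta> b) = \<phi> (T b))"

theorem weak_2_local_symmetric_clinear:
  fixes \<Delta> :: "'a::cstar_algebra \<Rightarrow> 'b::cstar_algebra"
  assumes "weak_2_local_symmetric \<Delta>"
  shows "clinear \<Delta>"
proof -
  have local: "\<exists>T. (\<forall>x y. T (x + y) = T x + T y) \<and> (\<forall>c x. T (c *\<^sub>C x) = c *\<^sub>C T x) \<and>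
      (\<forall>x. T (x\<^sup>\<star>) = (T x)\<^sup>\<star>) \<and> \<phi> (\<Delta> a) = \<phi> (T a) \<and> \<phi> (\<Delta> b) = \<phi> (T b)"
    if "\<phi> \<in> banach_dual" for a b \<phi>
    using assms that unfolding weak_2_local_symmetric_def clinear_iff by blast
  {
    fix \<phi> :: "'b \<Rightarrow> complex"
    assume \<phi>: "\<phi> \<in> banach_dual" and sym: "\<And>z. \<phi> (z\<^sup>\<star>) = cnj (\<phi> z)"
    have \<phi>_add: "\<phi> (x + y) = \<phi> x + \<phi> y" and \<phi>_scale: "\<phi> (c *\<^sub>C x) = c * \<phi> x" for x y c
      using \<phi> by (simp_all add: banach_dual_def clinear_iff scaleC_complex_def)
    have scale: "\<phi> (\<Delta> (c *\<^sub>C a)) = c * \<phi> (\<Delta> a)" for c a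
      using local[OF \<phi>, of a "c *\<^sub>C a"] by (auto simp: \<phi>_scale)
    have real: "\<phi> (T h) \<in> \<real>" if "\<forall>x. T (x\<^sup>\<star>) = (T x)\<^sup>\<star>" "h\<^sup>\<star> = h" for T and h :: 'a
      using that sym[of "T h"] by (metis Reals_cnj_iff)
    \<comment> \<open>\<open>\<phi> (T h)\<close> and \<open>\<phi> (T k)\<close> are real, hence
      they are the real and imaginary parts of
      \<open>\<phi> (T h) + \<i> * \<phi> (T k)\<close>.\<close>
    have determined: "Re (\<phi> (\<Delta> (h + \<i> *\<^sub>C k))) = Re (\<phi> (T h))"
        "Im (\<phi> (\<Delta> (h + \<i> *\<^sub>C k))) = Re (\<phi> (T k))"
      if "\<forall>x y. T (x + y) = T x + T y" "\<forall>c x. T (c *\<^sub>C x) = c *\<^sub>C T x"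
        "\<forall>x. T (x\<^sup>\<star>) = (T x)\<^sup>\<star>" "\<phi> (\<Delta> (h + \<i> *\<^sub>C k)) = \<phi> (T (h + \<i> *\<^sub>C k))"
        "h\<^sup>\<star> = h" "k\<^sup>\<star> = k" for T and h k :: 'a
      using that real[of T h] real[of T k]
      by (simp_all add: \<phi>_add \<phi>_scale complex_is_Real_iff)
    have split: "\<phi> (\<Delta> (h + \<i> *\<^sub>C k)) = \<phi> (\<Delta> h) + \<i> * \<phi> (\<Delta> k)" if hk: "h\<^sup>\<star> = h" "k\<^sup>\<star> = k" for h k
    proof -
      \<comment> \<open>This equation and the next may come from different maps \<open>T\<close>;
        the common value at \<open>h + \<i> *\<^sub>C k\<close> links them.\<close>
      have "Re (\<phi> (\<Delta> (h + \<i> *\<^sub>C k))) = \<phi> (\<Delta> h)"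
        using local[OF \<phi>, of "h + \<i> *\<^sub>C k" h] determined(1)[OF _ _ _ _ hk] real[OF _ hk(1)]
        by (metis of_real_Re)
      moreover have "Im (\<phi> (\<Delta> (h + \<i> *\<^sub>C k))) = \<phi> (\<Delta> k)"
        using local[OF \<phi>, of "h + \<i> *\<^sub>C k" k] determined(2)[OF _ _ _ _ hk] real[OF _ hk(2)]
        by (metis of_real_Re)
      ultimately show ?thesis by (metis complex_eq)
    qed
    have add_sa: "\<phi> (\<Delta> (h + k)) = \<phi> (\<Delta> h) + \<phi> (\<Delta> k)" if hk: "h\<^sup>\<star> = h" "k\<^sup>\<star> = k" for h k
    proof -
      obtain T where T: "\<forall>x y. T (x + y) = T x + T y" "\<forall>c x. T (c *\<^sub>C x) = c *\<^sub>C T x"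
          "\<forall>x. T (x\<^sup>\<star>) = (T x)\<^sup>\<star>" "\<phi> (\<Delta> (h + \<i> *\<^sub>C k)) = \<phi> (T (h + \<i> *\<^sub>C k))"
          "\<phi> (\<Delta> (h + k)) = \<phi> (T (h + k))"
        using local[OF \<phi>] by blast
      have \<Delta>real: "\<phi> (\<Delta> g) \<in> \<real>" if "g\<^sup>\<star> = g" for g
        using local[OF \<phi>, of g g] real[OF _ that] by metis
      \<comment> \<open>\<open>T\<close> was chosen to agree only at
        \<open>h + \<i> *\<^sub>C k\<close> and \<open>h + k\<close>. Comparing real and imaginary
        parts at the former, through \<open>split\<close>, extends agreement to \<open>h\<close> and
        \<open>k\<close>.\<close>
      have "\<phi> (\<Delta> h) = \<phi> (T h)" "\<phi> (\<Delta> k) = \<phi> (T k)"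
        using determined[OF T(1-4) hk] split[OF hk] \<Delta>real[OF hk(1)] \<Delta>real[OF hk(2)]
          real[OF T(3) hk(1)] real[OF T(3) hk(2)]
        by (simp_all add: complex_eq_iff complex_is_Real_iff)
      then show ?thesis
        using T(1,5) by (simp add: \<phi>_add)
    qed
    have "\<phi> (\<Delta> (a + b)) = \<phi> (\<Delta> a) + \<phi> (\<Delta> b)" for a b
    proof -
      \<comment> \<open>Reduces additivity at arbitrary elements to the self-adjoint case.\<close>
      have parts: "\<phi> (\<Delta> z) = \<phi> (\<Delta> (re_part z)) + \<i> * \<phi> (\<Delta> (im_part z))" for z
        using split[OF star_re_part star_im_part, of z z] by (simp add: re_im_part)
      show ?thesis
        unfolding parts[of "a + b"] parts[of a] parts[of b] re_part_add im_part_add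
        by (simp add: add_sa star_re_part star_im_part algebra_simps)
    qed
    then have "\<phi> (\<Delta> (a + b)) = \<phi> (\<Delta> a + \<Delta> b)" "\<phi> (\<Delta> (c *\<^sub>C a)) = \<phi> (c *\<^sub>C \<Delta> a)" for a b c
      by (simp_all add: \<phi>_add \<phi>_scale scale)
  }
  then show ?thesis
    unfolding clinear_iff by (blast intro: symmetric_functional_separates)
qed

theorem corollary2p6:
  fixes \<Delta>\<^sub>1 :: "'a::cstar_algebra \<Rightarrow> 'a"
    and \<Delta>\<^sub>2 :: "'b::cstar_algebra \<Rightarrow> 'c::cstar_algebra"
  shows "(weak_2_local_star_derivation \<Delta>\<^sub>1 \<longrightarrow> clinear \<Delta>\<^sub>1) \<and>
         (weak_2_local_star_homomorphism \<Delta>\<^sub>2 \<longrightarrow> clinear \<Delta>\<^sub>2)"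
proof (intro conjI impI; rule weak_2_local_symmetric_clinear)
  assume "weak_2_local_star_derivation \<Delta>\<^sub>1"
  then show "weak_2_local_symmetric \<Delta>\<^sub>1"
    unfolding weak_2_local_star_derivation_def weak_2_local_symmetric_def
      star_derivation_def derivation_def by meson
next
  assume "weak_2_local_star_homomorphism \<Delta>\<^sub>2"
  then show "weak_2_local_symmetric \<Delta>\<^sub>2"
    unfolding weak_2_local_star_homomorphism_def weak_2_local_symmetric_def
      star_homomorphism_def by meson
qed

end
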